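(* Let $q^*=(q^*(e))_{e\in E}$ be a feasible solution of the primal program $$\text{maximize }\sum_{e\in E}\hat g(q(e)\mid e)\quad\text{subject to}\quad \sum_{e\in E}q(e)\le 1,\quad \sum_{e\in\mathrm{OUT}(v)}q(e)=\sum_{e\in\mathrm{IN}(v)}q(e)\ \ \forall v\in V,\quad q\ge 0,$$ and let $(\lambda^*,\mu^* )$ with $\lambda^*\in\mathbb R$, $\mu^*\in\mathbb R^V$ be a feasible solution of the dual program $$\text{maximize } h(\lambda,\mu)\quad\text{subject to}\quad\lambda\ge 0 .$$ Then $q^*$ is primal optimal and $(\lambda^*,\mu^* )$ is dual optimal with $-\sum_{e\in E}\hat g(q^*(e)\mid e)=h(\lambda^*,\mu^* )$ if and only if $$\lambda^*\Big(\sum_{e\in E}q^*(e)-1\Big)=0$$ and $$\hat g'(q^*(e)\mid e)=\lambda^*+\mu^*_s-\mu^*_t\qquad\text{for every edge } e=(s,t)\in E .$$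
   Context: $G=(V,E)$ is a finite strongly connected digraph; an edge $e=(s,t)$ has origin $s$ and destination $t$; $\mathrm{OUT}(v)$ and $\mathrm{IN}(v)$ are the sets of edges starting, respectively ending, at $v$. For each $e\in E$, $\hat g(\cdot\mid e):\mathbb R\to\mathbb R$ is a concave differentiable function of the flow on $e$ with derivative $\hat g'(\cdot\mid e)$. The primal program is the problem of finding an optimal stable (stationary) flow for a ride-sharing platform with total driver mass $1$; it is viewed as minimizing $-\sum_e\hat g(q(e)\mid e)$. The Lagrangian is, for $q\in\mathbb R^E$, $\lambda\in\mathbb R$, $\mu\in\mathbb R^V$, $$L(q,\lambda,\mu)=-\sum_{e\in E}\hat g(q(e)\mid e)+\lambda\Big(\sum_{e\in E}q(e)-1\Big)+\sum_{v\in V}\mu_v\Big(\sum_{e\in\mathrm{OUT}(v)}q(e)-\sum_{e\in\mathrm{IN}(v)}q(e)\Big),$$ and the Lagrangian dual function is $h(\lambda,\mu)=\inf_{q\in\mathbb R^E}L(q,\lambda,\mu)\in[-\infty,\infty)$ (the infimum is unconstrained). A primal (dual) feasible solution is optimal if it maximizes the corresponding objective over all primal (dual) feasible solutions. *)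

theory Defs
  imports "HOL-Analysis.Analysis" "Graph_Theory.Graph_Theory"
begin

(* Vectors in R^E and R^V are total functions on 'a * 'a and 'a. All definitions below read q only on
   the arcs and mu only on the vertices, so values elsewhere are irrelevant. *)

definition primal_objective ::
  "'a pair_pre_digraph \<Rightarrow> ('a \<times> 'a \<Rightarrow> real \<Rightarrow> real) \<Rightarrow> ('a \<times> 'a \<Rightarrow> real) \<Rightarrow> real" where
  "primal_objective G g q = (\<Sum>e\<in>parcs G. g e (q e))"

definition primal_feasible :: "'a pair_pre_digraph \<Rightarrow> ('a \<times> 'a \<Rightarrow> real) \<Rightarrow> bool" where
  "primal_feasible G q \<longleftrightarrow>
     (\<Sum>e\<in>parcs G. q e) \<le> 1 \<and>
     (\<forall>v\<in>pverts G. (\<Sum>e\<in>out_arcs G v. q e) = (\<Sum>e\<in>in_arcs G v. q e)) \<and>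
     (\<forall>e\<in>parcs G. 0 \<le> q e)"

definition primal_optimal ::
  "'a pair_pre_digraph \<Rightarrow> ('a \<times> 'a \<Rightarrow> real \<Rightarrow> real) \<Rightarrow> ('a \<times> 'a \<Rightarrow> real) \<Rightarrow> bool" where
  "primal_optimal G g q \<longleftrightarrow>
     primal_feasible G q \<and>
     (\<forall>q'. primal_feasible G q' \<longrightarrow> primal_objective G g q' \<le> primal_objective G g q)"

definition Lagrangian ::
  "'a pair_pre_digraph \<Rightarrow> ('a \<times> 'a \<Rightarrow> real \<Rightarrow> real) \<Rightarrow>
     ('a \<times> 'a \<Rightarrow> real) \<Rightarrow> real \<Rightarrow> ('a \<Rightarrow> real) \<Rightarrow> real" where
  "Lagrangian G g q lam mu =
     - (\<Sum>e\<in>parcs G. g e (q e))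
     + lam * ((\<Sum>e\<in>parcs G. q e) - 1)
     + (\<Sum>v\<in>pverts G. mu v * ((\<Sum>e\<in>out_arcs G v. q e) - (\<Sum>e\<in>in_arcs G v. q e)))"

(* The infimum is over all q, not only q >= 0, and may be -\<infinity>; hence the values in ereal. *)
definition dual_function ::
  "'a pair_pre_digraph \<Rightarrow> ('a \<times> 'a \<Rightarrow> real \<Rightarrow> real) \<Rightarrow> real \<Rightarrow> ('a \<Rightarrow> real) \<Rightarrow> ereal" where
  "dual_function G g lam mu = (INF q. ereal (Lagrangian G g q lam mu))"

definition dual_feasible :: "real \<Rightarrow> ('a \<Rightarrow> real) \<Rightarrow> bool" where
  "dual_feasible lam mu \<longleftrightarrow> 0 \<le> lam"

definition dual_optimal ::
  "'a pair_pre_digraph \<Rightarrow> ('a \<times> 'a \<Rightarrow> real \<Rightarrow> real) \<Rightarrow> real \<Rightarrow> ('a \<Rightarrow> real) \<Rightarrow> bool" where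
  "dual_optimal G g lam mu \<longleftrightarrow>
     dual_feasible lam mu \<and>
     (\<forall>lam' mu'. dual_feasible lam' mu' \<longrightarrow> dual_function G g lam' mu' \<le> dual_function G g lam mu)"

end

(* Since every arc leaves one vertex and enters one vertex, the Lagrangian splits as
   sum over e = (s, t) of (c e * q e - g e (q e)) - lam  with  c e = lam + mu s - mu t.
   Hence q minimizes L(., lam, mu) iff every summand is minimal at q e, which by concavity is
   the derivative condition. Weak duality then gives the equivalence: h(lam, mu) <= L(q, lam, mu)
   <= - objective(q), where the second inequality is tight iff complementary slackness holds and
   the first one iff q minimizes L(., lam, mu). *)

theory Submission
  imports Defs
begin

text \<open>A global minimum of the differentiable function \<open>c * y - f y\<close> has zero
  derivative. Conversely, a concave function lies below its tangent.\<close>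

lemma concave_supported_iff_deriv:
  fixes f :: "real \<Rightarrow> real"
  assumes conc: "concave_on UNIV f" and diff: "f differentiable (at x)"
  shows "(\<forall>y. c * x - f x \<le> c * y - f y) \<longleftrightarrow> deriv f x = c"
proof
  have D: "(f has_real_derivative deriv f x) (at x)"
    using diff DERIV_deriv_iff_real_differentiable by blast
  {
    assume min: "\<forall>y. c * x - f x \<le> c * y - f y"
    have "((\<lambda>y. c * y - f y) has_real_derivative c - deriv f x) (at x)"
      by (auto intro!: derivative_eq_intros D)
    then have "c - deriv f x = 0"
      \<comment> \<open>The minimum is global, so any positive radius serves.\<close>
      by (rule DERIV_local_min[where d = 1]) (use min in auto)
    then show "deriv f x = c" by simp
  next
    assume c: "deriv f x = c"
    show "\<forall>y. c * x - f x \<le> c * y - f y"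
    proof
      fix y
      \<comment> \<open>Tangent inequality at \<open>x\<close> for the convex function
        \<open>- f\<close>.\<close>
      have "- f y - (- f x) \<ge> - deriv f x * (y - x)"
        by (rule convex_on_imp_above_tangent[where A = UNIV])
          (use conc D in \<open>auto simp: concave_on_def intro!: derivative_eq_intros\<close>)
      then show "c * x - f x \<le> c * y - f y" by (simp add: c algebra_simps)
    qed
  }
qed

text \<open>The coordinates of \<open>q'\<close> vary independently, so changing \<open>q\<close> at
  the single index \<open>e\<close> isolates its summand.\<close>

lemma minimizes_sum_iff:
  fixes f :: "'b \<Rightarrow> real \<Rightarrow> real"
  assumes "finite A"
  shows "(\<forall>q'. (\<Sum>e\<in>A. f e (q e)) \<le> (\<Sum>e\<in>A. f e (q' e)))
    \<longleftrightarrow> (\<forall>e\<in>A. \<forall>y. f e (q e) \<le> f e y)"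
proof (intro iffI ballI allI)
  fix e y
  assume min: "\<forall>q'. (\<Sum>e\<in>A. f e (q e)) \<le> (\<Sum>e\<in>A. f e (q' e))" and e: "e \<in> A"
  have "(\<Sum>a\<in>A - {e}. f a ((q(e := y)) a)) = (\<Sum>a\<in>A - {e}. f a (q a))"
    by (rule sum.cong) auto
  with min[rule_format, of "q(e := y)"] show "f e (q e) \<le> f e y"
    by (simp add: sum.remove[OF assms e])
qed (auto intro: sum_mono)

text \<open>The sets \<open>out_arcs G v\<close> partition the arcs by tail, and \<open>mu v\<close>
  is constant on each class.\<close>

lemma (in pair_fin_digraph) sum_mult_out_arcs:
  fixes mu :: "'a \<Rightarrow> real"
  shows "(\<Sum>v\<in>pverts G. mu v * (\<Sum>e\<in>out_arcs G v. q e)) = (\<Sum>e\<in>parcs G. mu (fst e) * q e)"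
proof -
  have "(\<Sum>e\<in>parcs G. mu (fst e) * q e)
      = (\<Sum>v\<in>pverts G. \<Sum>e\<in>{e \<in> parcs G. fst e = v}. mu (fst e) * q e)"
    by (rule sum.group[symmetric]) (auto dest: in_arcsD1)
  then show ?thesis by (simp add: out_arcs_def sum_distrib_left)
qed

lemma (in pair_fin_digraph) sum_mult_in_arcs:
  fixes mu :: "'a \<Rightarrow> real"
  shows "(\<Sum>v\<in>pverts G. mu v * (\<Sum>e\<in>in_arcs G v. q e)) = (\<Sum>e\<in>parcs G. mu (snd e) * q e)"
proof -
  have "(\<Sum>e\<in>parcs G. mu (snd e) * q e)
      = (\<Sum>v\<in>pverts G. \<Sum>e\<in>{e \<in> parcs G. snd e = v}. mu (snd e) * q e)"
    by (rule sum.group[symmetric]) (auto dest: in_arcsD2)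
  then show ?thesis by (simp add: in_arcs_def sum_distrib_left)
qed

lemma (in pair_fin_digraph) Lagrangian_eq_sum_arcs:
  "Lagrangian G g q lam mu
    = (\<Sum>e\<in>parcs G. (lam + mu (fst e) - mu (snd e)) * q e - g e (q e)) - lam"
  unfolding Lagrangian_def
  by (simp add: right_diff_distrib sum_subtractf sum_mult_out_arcs sum_mult_in_arcs)
    (simp add: algebra_simps sum.distrib sum_subtractf sum_distrib_left)

text \<open>Since \<open>q'\<close> ranges over all real vectors, stationarity is an equality on
  every arc, even where \<open>q\<close> vanishes.\<close>

lemma (in pair_fin_digraph) Lagrangian_minimal_iff:
  assumes "\<And>e. e \<in> parcs G \<Longrightarrow> concave_on UNIV (g e)"
    and "\<And>e. e \<in> parcs G \<Longrightarrow> g e differentiable_on UNIV"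
  shows "(\<forall>q'. Lagrangian G g q lam mu \<le> Lagrangian G g q' lam mu)
    \<longleftrightarrow> (\<forall>(s, t)\<in>parcs G. deriv (g (s, t)) (q (s, t)) = lam + mu s - mu t)"
proof -
  have "(\<forall>q'. Lagrangian G g q lam mu \<le> Lagrangian G g q' lam mu)
    \<longleftrightarrow> (\<forall>e\<in>parcs G. \<forall>y. (lam + mu (fst e) - mu (snd e)) * q e - g e (q e)
          \<le> (lam + mu (fst e) - mu (snd e)) * y - g e y)"
    using minimizes_sum_iff[OF pair_finite_arcs,
        of "\<lambda>e y. (lam + mu (fst e) - mu (snd e)) * y - g e y" q]
    by (simp add: Lagrangian_eq_sum_arcs)
  also have "\<dots> \<longleftrightarrow> (\<forall>e\<in>parcs G. deriv (g e) (q e) = lam + mu (fst e) - mu (snd e))"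
    using assms by (intro ball_cong refl concave_supported_iff_deriv)
      (auto simp: differentiable_on_def)
  finally show ?thesis by auto
qed

text \<open>Flow conservation cancels the \<open>mu\<close> terms.\<close>

lemma Lagrangian_of_primal_feasible:
  assumes "primal_feasible G q"
  shows "Lagrangian G g q lam mu
    = - primal_objective G g q + lam * ((\<Sum>e\<in>parcs G. q e) - 1)"
  using assms by (simp add: Lagrangian_def primal_feasible_def primal_objective_def)

lemma dual_function_le_Lagrangian:
  "dual_function G g lam mu \<le> ereal (Lagrangian G g q lam mu)"
  unfolding dual_function_def by (rule INF_lower) simp

lemma dual_function_eq_Lagrangian_iff:
  "dual_function G g lam mu = ereal (Lagrangian G g q lam mu)
    \<longleftrightarrow> (\<forall>q'. Lagrangian G g q lam mu \<le> Lagrangian G g q' lam mu)"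
proof -
  have "dual_function G g lam mu = ereal (Lagrangian G g q lam mu)
    \<longleftrightarrow> ereal (Lagrangian G g q lam mu) \<le> dual_function G g lam mu"
    using dual_function_le_Lagrangian[of G g lam mu q] by auto
  then show ?thesis by (simp add: dual_function_def le_INF_iff)
qed

lemma slackness_nonpos:
  assumes "primal_feasible G q" and "dual_feasible lam mu"
  shows "lam * ((\<Sum>e\<in>parcs G. q e) - 1) \<le> 0"
  using assms by (simp add: primal_feasible_def dual_feasible_def mult_nonneg_nonpos)

lemma weak_duality:
  assumes "primal_feasible G q" and "dual_feasible lam mu"
  shows "dual_function G g lam mu \<le> ereal (- primal_objective G g q)"
proof -
  have "Lagrangian G g q lam mu \<le> - primal_objective G g q"
    using slackness_nonpos[OF assms] by (simp add: Lagrangian_of_primal_feasible[OF assms(1)])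
  then show ?thesis
    using dual_function_le_Lagrangian[of G g lam mu q] order_trans ereal_less_eq(3) by blast
qed

text \<open>By weak duality, the common value bounds the objectives of all feasible points on both
  sides, and here both bounds are attained.\<close>

lemma zero_gap_imp_optimal:
  assumes q: "primal_feasible G q" and lm: "dual_feasible lam mu"
    and gap: "ereal (- primal_objective G g q) = dual_function G g lam mu"
  shows "primal_optimal G g q" and "dual_optimal G g lam mu"
proof -
  have "primal_objective G g q' \<le> primal_objective G g q" if "primal_feasible G q'" for q'
    using weak_duality[OF that lm, of g] by (simp flip: gap)
  then show "primal_optimal G g q" using q by (simp add: primal_optimal_def)
  have "dual_function G g lam' mu' \<le> dual_function G g lam mu" if "dual_feasible lam' mu'"
    for lam' mu'
    using weak_duality[OF q that, of g] by (simp flip: gap)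
  then show "dual_optimal G g lam mu" using lm by (simp add: dual_optimal_def)
qed

lemma zero_gap_iff:
  assumes "primal_feasible G q" and "dual_feasible lam mu"
  shows "ereal (- primal_objective G g q) = dual_function G g lam mu
    \<longleftrightarrow> lam * ((\<Sum>e\<in>parcs G. q e) - 1) = 0
      \<and> (\<forall>q'. Lagrangian G g q lam mu \<le> Lagrangian G g q' lam mu)"
    (is "?gap \<longleftrightarrow> ?slack = 0 \<and> ?min")
proof -
  note L = Lagrangian_of_primal_feasible[OF assms(1), of g lam mu]
  have "?slack = 0" if ?gap
  proof -
    \<comment> \<open>With zero gap the bound by the dual function reads this way; it makes the
      slackness term nonnegative, and feasibility makes it nonpositive.\<close>
    have "- primal_objective G g q \<le> Lagrangian G g q lam mu"
      using dual_function_le_Lagrangian[of G g lam mu q] by (simp flip: that)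
    then show ?thesis using slackness_nonpos[OF assms] L by linarith
  qed
  \<comment> \<open>Without slackness term the Lagrangian at \<open>q\<close> is the negated
    objective, so zero gap says that the infimum is attained at \<open>q\<close>.\<close>
  moreover have "?gap \<longleftrightarrow> ?min" if "?slack = 0"
    using dual_function_eq_Lagrangian_iff[of G g lam mu q] L that by auto
  ultimately show ?thesis by blast
qed

theorem theorem5p1:
  fixes G :: "'a pair_pre_digraph"
    and g :: "'a \<times> 'a \<Rightarrow> real \<Rightarrow> real"
    and q :: "'a \<times> 'a \<Rightarrow> real"
    and lam :: real
    and mu :: "'a \<Rightarrow> real"
  assumes "pair_fin_digraph G"
    and "strongly_connected G"
    and "\<And>e. e \<in> parcs G \<Longrightarrow> concave_on UNIV (g e)"
    and "\<And>e. e \<in> parcs G \<Longrightarrow> g e differentiable_on UNIV"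
    and "primal_feasible G q"
    and "dual_feasible lam mu"
  shows "(primal_optimal G g q \<and> dual_optimal G g lam mu \<and>
            ereal (- primal_objective G g q) = dual_function G g lam mu)
         \<longleftrightarrow>
         (lam * ((\<Sum>e\<in>parcs G. q e) - 1) = 0 \<and>
            (\<forall>(s, t)\<in>parcs G. deriv (g (s, t)) (q (s, t)) = lam + mu s - mu t))"
proof -
  interpret pair_fin_digraph G by fact
  have "(\<forall>q'. Lagrangian G g q lam mu \<le> Lagrangian G g q' lam mu)
      \<longleftrightarrow> (\<forall>(s, t)\<in>parcs G. deriv (g (s, t)) (q (s, t)) = lam + mu s - mu t)"
    by (rule Lagrangian_minimal_iff) (fact assms(3,4))+
  \<comment> \<open>A zero gap yields both optimality claims, so the left-hand side is equivalent to
    zero gap.\<close>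
  then show ?thesis
    using zero_gap_iff[OF assms(5,6), of g] zero_gap_imp_optimal[OF assms(5,6), of g] by argo
qed

end
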